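(* The function $E(h)=M(h)-hM'(h)$, $h\ge0$, is nonincreasing and continuous on $[0,\infty)$, with $E(0)=M(0)$ and $\lim_{h\to\infty}E(h)=0$.
   Context: Let $2\mathbb{N}=\{2,4,6,\dots\}$ and let $(c_p)_{p\in2\mathbb{N}}$ be real numbers, $c_p\ne0$ for at least one $p$, with $\sum_p 2^pc_p^2<\infty$. Put $\Sigma_N=\{-1,+1\}^N$. The mixed even $p$-spin Hamiltonian is $H_N(\sigma)=\sum_{p\in 2\mathbb{N}}c_pN^{-(p-1)/2}\sum_{1\le i_1,\dots,i_p\le N}g_{i_1,\dots,i_p}\sigma_{i_1}\cdots\sigma_{i_p}$, $\sigma\in\Sigma_N$, where all $g_{i_1,\dots,i_p}$ are i.i.d. standard Gaussian. Let $H_N^h(\sigma)=H_N(\sigma)+h\sum_{i=1}^N\sigma_i$ and $L_N^h=\max_{\sigma\in\Sigma_N}H_N^h(\sigma)/N$. For every $h\in\mathbb{R}$ the limit $M(h)=\lim_{N\to\infty}L_N^h$ exists a.s. and is nonrandom; the function $M$ is differentiable on $\mathbb R$. *)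

theory Defs
  imports "HOL-Probability.Probability"
begin

definition pos_evens :: "nat set" where
  "pos_evens = {p. even p \<and> 0 < p}"

(* A multi-index (i_1,...,i_p) is the list [i_1,...,i_p]; positions are numbered from 1. *)

definition multi_indices :: "nat \<Rightarrow> nat \<Rightarrow> nat list set" where
  "multi_indices N p = {is. length is = p \<and> set is \<subseteq> {1..N}}"

(* One disorder array serves all N: the variable attached to a multi-index does not depend on N. *)

definition all_multi_indices :: "nat list set" where
  "all_multi_indices = (\<Union>N. \<Union>p\<in>pos_evens. multi_indices N p)"

definition iid_std_normal :: "'a measure \<Rightarrow> 'i set \<Rightarrow> ('i \<Rightarrow> 'a \<Rightarrow> real) \<Rightarrow> bool" where
  "iid_std_normal P I g \<longleftrightarrow>
     prob_space.indep_vars P (\<lambda>_. borel) g I \<and>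
     (\<forall>i\<in>I. distributed P lborel (g i) (\<lambda>x. ennreal (std_normal_density x)))"

definition spin_configs :: "nat \<Rightarrow> (nat \<Rightarrow> real) set" where
  "spin_configs N = {1..N} \<rightarrow>\<^sub>E {-1, 1}"

(* The arguments x are a realisation of the disorder. When sum_p 2^p c_p^2 is finite, the
   unordered sum over p converges (absolutely) for almost every realisation. *)

definition hamiltonian ::
    "(nat \<Rightarrow> real) \<Rightarrow> (nat list \<Rightarrow> real) \<Rightarrow> nat \<Rightarrow> (nat \<Rightarrow> real) \<Rightarrow> real" where
  "hamiltonian c x N \<sigma> =
     (\<Sum>\<^sub>\<infinity>p\<in>pos_evens. c p * real N powr (- (real p - 1) / 2) *
        (\<Sum>is\<in>multi_indices N p. x is * prod_list (map \<sigma> is)))"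

definition field_hamiltonian ::
    "(nat \<Rightarrow> real) \<Rightarrow> (nat list \<Rightarrow> real) \<Rightarrow> real \<Rightarrow> nat \<Rightarrow> (nat \<Rightarrow> real) \<Rightarrow> real" where
  "field_hamiltonian c x h N \<sigma> = hamiltonian c x N \<sigma> + h * (\<Sum>i=1..N. \<sigma> i)"

definition max_energy :: "(nat \<Rightarrow> real) \<Rightarrow> (nat list \<Rightarrow> real) \<Rightarrow> real \<Rightarrow> nat \<Rightarrow> real" where
  "max_energy c x h N = Max ((\<lambda>\<sigma>. field_hamiltonian c x h N \<sigma> / real N) ` spin_configs N)"

definition E_of :: "(real \<Rightarrow> real) \<Rightarrow> real \<Rightarrow> real" where
  "E_of M h = M h - h * deriv M h"

end

theory Submission
  imports Defs "HOL-Real_Asymp.Real_Asymp"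
begin

text \<open>As a limit of maxima of affine functions of the field, \<open>M\<close> is convex, and \<open>E_of M h\<close> is the
  intercept at \<open>0\<close> of its tangent at \<open>h\<close>; monotonicity and continuity follow from the tangent
  inequality and the continuity of \<open>M'\<close>. At infinity it suffices that \<open>M h - h\<close> tends to \<open>0\<close>. Let \<open>C\<close>
  be the sum of the \<open>(c p)\<^sup>2\<close>. Since \<open>H\<^sub>N(\<sigma>)\<close> is centred Gaussian with variance \<open>N C\<close>, summing
  \<open>exp (b H\<^sub>N(\<sigma>) + b h (\<Sum>\<^sub>i \<sigma>\<^sub>i - N))\<close> over the cube bounds the \<open>b\<close>-exponential moment of
  \<open>N (L\<^sub>N - h)\<close> by \<open>exp (N (b\<^sup>2 C / 2 + ln (1 + exp (- 2 b h))))\<close>, so that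
  \<open>M h - h \<le> b C / 2 + ln (1 + exp (- 2 b h)) / b\<close>; the configuration of all ones gives the lower bound
  \<open>- b C / 2\<close>. Let \<open>h\<close> tend to infinity and then \<open>b\<close> to \<open>0\<close>.\<close>

section \<open>Exponential moments of the Hamiltonian\<close>

context prob_space
begin

text \<open>Completing the square turns the weighted standard density into
  \<open>exp (t\<^sup>2 / 2)\<close> times the normal density with mean \<open>t\<close>, which has
  mass 1.\<close>

lemma nn_integral_exp_std_normal:
  assumes "distributed M lborel X (\<lambda>x. ennreal (std_normal_density x))"
  shows "(\<integral>\<^sup>+\<omega>. ennreal (exp (t * X \<omega>)) \<partial>M) = ennreal (exp (t\<^sup>2 / 2))"
proof -
  have shift: "ennreal (std_normal_density x) * ennreal (exp (t * x))
      = ennreal (exp (t\<^sup>2 / 2)) * ennreal (normal_density t 1 x)" for x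
  proof -
    have "exp (- x\<^sup>2 / 2) * exp (t * x) = exp (t\<^sup>2 / 2) * exp (- (x - t)\<^sup>2 / 2)"
      unfolding exp_add[symmetric] by (simp add: power2_eq_square algebra_simps diff_divide_distrib add_divide_distrib)
    then show ?thesis
      by (simp add: normal_density_def ennreal_mult'[symmetric] divide_simps)
  qed
  interpret N: prob_space "density lborel (\<lambda>x. ennreal (normal_density t 1 x))"
    by (rule prob_space_normal_density) simp
  have mass: "(\<integral>\<^sup>+x. ennreal (normal_density t 1 x) \<partial>lborel) = 1"
    using N.emeasure_space_1 by (simp add: emeasure_density)
  have "(\<integral>\<^sup>+\<omega>. ennreal (exp (t * X \<omega>)) \<partial>M)
      = (\<integral>\<^sup>+x. ennreal (std_normal_density x) * ennreal (exp (t * x)) \<partial>lborel)"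
    by (rule distributed_nn_integral[OF assms, symmetric]) simp
  also have "\<dots> = ennreal (exp (t\<^sup>2 / 2)) * (\<integral>\<^sup>+x. ennreal (normal_density t 1 x) \<partial>lborel)"
    unfolding shift by (rule nn_integral_cmult) simp
  finally show ?thesis
    using mass by simp
qed

lemma iid_std_normal_measurable:
  assumes "iid_std_normal M I g" "i \<in> I"
  shows "g i \<in> borel_measurable M"
  using assms unfolding iid_std_normal_def indep_vars_def by auto

text \<open>Independence factors the exponential moment over the multi-indices. Nonnegative
  integrals spare any integrability proof.\<close>

lemma nn_integral_exp_linear_std_normal:
  assumes g: "iid_std_normal M I g" and J: "finite J" "J \<subseteq> I"
  shows "(\<integral>\<^sup>+\<omega>. ennreal (exp (\<Sum>i\<in>J. a i * g i \<omega>)) \<partial>M) = ennreal (exp ((\<Sum>i\<in>J. (a i)\<^sup>2) / 2))"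
proof -
  have ind: "indep_vars (\<lambda>_. borel) g J"
    using g J unfolding iid_std_normal_def by (auto intro: indep_vars_subset)
  have ind': "indep_vars (\<lambda>_. borel) (\<lambda>i \<omega>. ennreal (exp (a i * g i \<omega>))) J"
    by (rule indep_vars_compose2[OF ind]) simp
  have "(\<integral>\<^sup>+\<omega>. ennreal (exp (\<Sum>i\<in>J. a i * g i \<omega>)) \<partial>M)
      = (\<integral>\<^sup>+\<omega>. (\<Prod>i\<in>J. ennreal (exp (a i * g i \<omega>))) \<partial>M)"
    by (simp add: exp_sum J(1) prod_ennreal)
  also have "\<dots> = (\<Prod>i\<in>J. \<integral>\<^sup>+\<omega>. ennreal (exp (a i * g i \<omega>)) \<partial>M)"
    by (rule indep_vars_nn_integral[OF J(1) ind']) simp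
  also have "\<dots> = (\<Prod>i\<in>J. ennreal (exp ((a i)\<^sup>2 / 2)))"
    using g J(2) by (intro prod.cong nn_integral_exp_std_normal refl) (auto simp: iid_std_normal_def)
  finally show ?thesis
    by (simp add: exp_sum J(1) prod_ennreal sum_divide_distrib)
qed

text \<open>Dividing by the standard deviation \<open>s\<close> gives a variable \<open>x\<close>
  whose exponential moments at 1 and -1 are \<open>exp (1 / 2)\<close>, and
  \<open>\<bar>x\<bar> \<le> exp x + exp (- x)\<close>. The constant is crude; what matters later is
  that the bound is linear in \<open>s\<close>.\<close>

lemma nn_integral_abs_linear_std_normal_le:
  assumes g: "iid_std_normal M I g" and J: "finite J" "J \<subseteq> I"
    and s: "(\<Sum>i\<in>J. (a i)\<^sup>2) = s\<^sup>2" "0 \<le> s"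
  shows "(\<integral>\<^sup>+\<omega>. ennreal \<bar>\<Sum>i\<in>J. a i * g i \<omega>\<bar> \<partial>M) \<le> ennreal (2 * exp (1 / 2) * s)"
proof (cases "s = 0")
  case True
  then have "\<forall>i\<in>J. a i = 0"
    using s(1) J(1) by (simp add: sum_nonneg_eq_0_iff)
  then show ?thesis
    by simp
next
  case False
  then have "0 < s"
    using s(2) by simp
  have [measurable]: "\<And>i. i \<in> J \<Longrightarrow> g i \<in> borel_measurable M"
    using iid_std_normal_measurable[OF g] J(2) by auto
  have moment: "(\<integral>\<^sup>+\<omega>. ennreal (exp (\<Sum>i\<in>J. (r * a i / s) * g i \<omega>)) \<partial>M) = ennreal (exp (1 / 2))"
    if "r\<^sup>2 = 1" for r
  proof -
    have "(\<Sum>i\<in>J. (r * a i / s)\<^sup>2) = (\<Sum>i\<in>J. (a i)\<^sup>2) / s\<^sup>2"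
      by (simp add: power_divide power_mult_distrib that sum_divide_distrib)
    also have "\<dots> = 1"
      using s(1) \<open>0 < s\<close> by simp
    finally show ?thesis
      by (simp only: nn_integral_exp_linear_std_normal[OF g J])
  qed
  have bound: "\<bar>\<Sum>i\<in>J. a i * g i \<omega>\<bar>
      \<le> s * (exp (\<Sum>i\<in>J. (1 * a i / s) * g i \<omega>) + exp (\<Sum>i\<in>J. (- 1 * a i / s) * g i \<omega>))" for \<omega>
  proof -
    define x where "x = (\<Sum>i\<in>J. a i * g i \<omega>) / s"
    have "\<bar>x\<bar> \<le> exp x + exp (- x)"
      using exp_ge_add_one_self[of x] exp_ge_add_one_self[of "- x"] exp_gt_zero[of x] exp_gt_zero[of "- x"]
      by linarith
    moreover have "(\<Sum>i\<in>J. (1 * a i / s) * g i \<omega>) = x" "(\<Sum>i\<in>J. (- 1 * a i / s) * g i \<omega>) = - x"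
      by (simp_all add: x_def sum_divide_distrib sum_negf)
    moreover have "\<bar>\<Sum>i\<in>J. a i * g i \<omega>\<bar> = s * \<bar>x\<bar>"
      using \<open>0 < s\<close> by (simp add: x_def)
    ultimately show ?thesis
      using \<open>0 < s\<close> by simp
  qed
  have "(\<integral>\<^sup>+\<omega>. ennreal \<bar>\<Sum>i\<in>J. a i * g i \<omega>\<bar> \<partial>M)
     \<le> (\<integral>\<^sup>+\<omega>. ennreal s * (ennreal (exp (\<Sum>i\<in>J. (1 * a i / s) * g i \<omega>))
          + ennreal (exp (\<Sum>i\<in>J. (- 1 * a i / s) * g i \<omega>))) \<partial>M)"
  proof (rule nn_integral_mono)
    fix \<omega>
    show "ennreal \<bar>\<Sum>i\<in>J. a i * g i \<omega>\<bar> \<le> ennreal s * (ennreal (exp (\<Sum>i\<in>J. (1 * a i / s) * g i \<omega>))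
          + ennreal (exp (\<Sum>i\<in>J. (- 1 * a i / s) * g i \<omega>)))"
      using ennreal_leI[OF bound[of \<omega>]] \<open>0 < s\<close> by (simp add: ennreal_mult)
  qed
  also have "\<dots> = ennreal s * (ennreal (exp (1 / 2)) + ennreal (exp (1 / 2)))"
    by (subst nn_integral_cmult, simp, subst nn_integral_add, simp, simp, subst moment, simp, subst moment, simp_all)
  also have "\<dots> = ennreal (2 * exp (1 / 2) * s)"
    using \<open>0 < s\<close> by (simp add: ennreal_mult[symmetric] ennreal_plus[symmetric] algebra_simps del: ennreal_plus)
  finally show ?thesis .
qed

end

section \<open>Coefficients and variance of the p-spin terms\<close>

lemma finite_multi_indices: "finite (multi_indices N p)"
  using finite_lists_length_eq[of "{1..N}" p]
  by (simp add: multi_indices_def conj_commute)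

lemma card_multi_indices: "card (multi_indices N p) = N ^ p"
  using card_lists_length_eq[of "{1..N}" p]
  by (simp add: multi_indices_def conj_commute)

lemma multi_indices_subset_all: "p \<in> pos_evens \<Longrightarrow> multi_indices N p \<subseteq> all_multi_indices"
  unfolding all_multi_indices_def by blast

lemma finite_spin_configs: "finite (spin_configs N)"
  unfolding spin_configs_def by (simp add: finite_PiE)

lemma spin_configs_nonempty: "spin_configs N \<noteq> {}"
  unfolding spin_configs_def by (simp add: PiE_eq_empty_iff)

lemma spin_configs_abs: "\<sigma> \<in> spin_configs N \<Longrightarrow> i \<in> {1..N} \<Longrightarrow> \<bar>\<sigma> i\<bar> = 1"
  unfolding spin_configs_def by (auto dest!: PiE_mem)

text \<open>The order \<open>p\<close> is read off the length of the multi-index, so that a single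
  coefficient function serves a union of index sets of different orders.\<close>

definition coupling :: "(nat \<Rightarrow> real) \<Rightarrow> nat \<Rightarrow> (nat \<Rightarrow> real) \<Rightarrow> nat list \<Rightarrow> real" where
  "coupling c N \<sigma> is = c (length is) * real N powr (- (real (length is) - 1) / 2) * prod_list (map \<sigma> is)"

text \<open>The p-spin part of the Hamiltonian, extended by 0 to all \<open>p\<close> so that
  ordinary series and their partial sums apply.\<close>

definition level :: "(nat \<Rightarrow> real) \<Rightarrow> (nat list \<Rightarrow> real) \<Rightarrow> nat \<Rightarrow> (nat \<Rightarrow> real) \<Rightarrow> nat \<Rightarrow> real" where
  "level c x N \<sigma> p = (if p \<in> pos_evens then \<Sum>is\<in>multi_indices N p. coupling c N \<sigma> is * x is else 0)"

lemma hamiltonian_eq_infsum_level: "hamiltonian c x N \<sigma> = (\<Sum>\<^sub>\<infinity>p. level c x N \<sigma> p)"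
  unfolding hamiltonian_def
proof (rule infsum_cong_neutral)
  fix p assume "p \<in> pos_evens \<inter> UNIV"
  then show "c p * real N powr (- (real p - 1) / 2) * (\<Sum>is\<in>multi_indices N p. x is * prod_list (map \<sigma> is))
      = level c x N \<sigma> p"
    unfolding level_def
    by (auto simp: sum_distrib_left multi_indices_def coupling_def intro!: sum.cong)
qed (auto simp: level_def)

text \<open>Spin products are 1 or -1, so each of the \<open>N ^ p\<close> multi-indices contributes
  \<open>(c p)\<^sup>2\<close> times \<open>N\<close> to the power \<open>1 - p\<close>. This sum is
  the variance of the p-spin part.\<close>

lemma sum_coupling_sq:
  assumes N: "1 \<le> N" and \<sigma>: "\<sigma> \<in> spin_configs N"
  shows "(\<Sum>is\<in>multi_indices N p. (coupling c N \<sigma> is)\<^sup>2) = real N * (c p)\<^sup>2"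
proof -
  have spin: "\<bar>prod_list (map \<sigma> is)\<bar> = 1" if "set is \<subseteq> {1..N}" for "is"
    using that by (induction "is") (use spin_configs_abs[OF \<sigma>] in \<open>auto simp: abs_mult\<close>)
  have "(coupling c N \<sigma> is)\<^sup>2 = (c p)\<^sup>2 * real N powr (1 - real p)" if "is \<in> multi_indices N p" for "is"
  proof -
    have "(real N powr (- (real p - 1) / 2))\<^sup>2 = real N powr (1 - real p)"
      using N by (simp add: powr_power diff_divide_distrib)
    moreover have "(prod_list (map \<sigma> is))\<^sup>2 = 1"
      using spin[of "is"] that by (metis (no_types, lifting) mem_Collect_eq multi_indices_def one_power2 power2_abs)
    ultimately show ?thesis
      using that by (simp add: coupling_def multi_indices_def power_mult_distrib)
  qed
  then have "(\<Sum>is\<in>multi_indices N p. (coupling c N \<sigma> is)\<^sup>2) = real N ^ p * ((c p)\<^sup>2 * real N powr (1 - real p))"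
    by (simp add: card_multi_indices)
  also have "real N ^ p = real N powr real p"
    using N by (simp add: powr_realpow)
  finally show ?thesis
    using N by (simp add: mult.left_commute powr_add[symmetric])
qed

text \<open>The expected absolute value of level \<open>p\<close> is at most a constant times
  \<open>\<bar>c p\<bar>\<close>. By monotone convergence the sum of the absolute values has finite
  expectation, hence is almost surely finite.\<close>

lemma (in prob_space) AE_summable_level:
  assumes g: "iid_std_normal M all_multi_indices g"
    and c: "summable (\<lambda>p. if p \<in> pos_evens then \<bar>c p\<bar> else 0)"
    and N: "1 \<le> N" and \<sigma>: "\<sigma> \<in> spin_configs N"
  shows "AE \<omega> in M. summable (\<lambda>p. \<bar>level c (\<lambda>is. g is \<omega>) N \<sigma> p\<bar>)"
proof -
  define K where "K = 2 * exp (1 / 2) * sqrt N"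
  have "0 \<le> K" by (simp add: K_def)
  have [measurable]: "(\<lambda>\<omega>. level c (\<lambda>is. g is \<omega>) N \<sigma> p) \<in> borel_measurable M" for p
  proof (cases "p \<in> pos_evens")
    case True
    then have [measurable]: "\<And>is. is \<in> multi_indices N p \<Longrightarrow> g is \<in> borel_measurable M"
      using iid_std_normal_measurable[OF g] multi_indices_subset_all by blast
    show ?thesis
      using True by (simp add: level_def)
  qed (simp add: level_def)
  have le: "(\<integral>\<^sup>+\<omega>. ennreal \<bar>level c (\<lambda>is. g is \<omega>) N \<sigma> p\<bar> \<partial>M)
      \<le> ennreal (K * (if p \<in> pos_evens then \<bar>c p\<bar> else 0))" for p
  proof (cases "p \<in> pos_evens")
    case True
    have "(\<Sum>is\<in>multi_indices N p. (coupling c N \<sigma> is)\<^sup>2) = (sqrt N * \<bar>c p\<bar>)\<^sup>2"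
      by (simp add: sum_coupling_sq[OF N \<sigma>] power_mult_distrib)
    from nn_integral_abs_linear_std_normal_le[OF g finite_multi_indices multi_indices_subset_all[OF True] this]
    show ?thesis
      using True by (simp add: level_def K_def mult.assoc)
  qed (simp add: level_def)
  have "(\<integral>\<^sup>+\<omega>. (\<Sum>p. ennreal \<bar>level c (\<lambda>is. g is \<omega>) N \<sigma> p\<bar>) \<partial>M)
      = (\<Sum>p. \<integral>\<^sup>+\<omega>. ennreal \<bar>level c (\<lambda>is. g is \<omega>) N \<sigma> p\<bar> \<partial>M)"
    by (rule nn_integral_suminf) simp
  also have "\<dots> \<le> (\<Sum>p. ennreal (K * (if p \<in> pos_evens then \<bar>c p\<bar> else 0)))"
    by (intro suminf_le le) auto
  also have "\<dots> = ennreal (\<Sum>p. K * (if p \<in> pos_evens then \<bar>c p\<bar> else 0))"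
    using \<open>0 \<le> K\<close> by (intro suminf_ennreal2 summable_mult c) auto
  finally have "(\<integral>\<^sup>+\<omega>. (\<Sum>p. ennreal \<bar>level c (\<lambda>is. g is \<omega>) N \<sigma> p\<bar>) \<partial>M) \<noteq> \<infinity>"
    by (auto simp: top_unique)
  then have "AE \<omega> in M. (\<Sum>p. ennreal \<bar>level c (\<lambda>is. g is \<omega>) N \<sigma> p\<bar>) \<noteq> \<infinity>"
    by (intro nn_integral_PInf_AE) simp_all
  then show ?thesis
    by eventually_elim (rule summable_suminf_not_top, auto)
qed

text \<open>The Hamiltonian is only almost surely the limit of its partial sums, so its moment bound is
  expressed through a measurable majorant.\<close>

definition exp_majorant :: "(nat \<Rightarrow> real) \<Rightarrow> (nat list \<Rightarrow> real) \<Rightarrow> nat \<Rightarrow> (nat \<Rightarrow> real) \<Rightarrow> real \<Rightarrow> ennreal" where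
  "exp_majorant c x N \<sigma> t = liminf (\<lambda>n. ennreal (exp (t * (\<Sum>p<n. level c x N \<sigma> p))))"

text \<open>Each partial sum is a finite Gaussian combination of variance at most
  \<open>N * C\<close>, and Fatou's lemma carries its moment bound to the lower limit. Wherever the
  levels are absolutely summable, the lower limit is a limit and equals the exponential of the
  Hamiltonian.\<close>

lemma (in prob_space) exp_majorant:
  assumes g: "iid_std_normal M all_multi_indices g"
    and c: "summable (\<lambda>p. if p \<in> pos_evens then \<bar>c p\<bar> else 0)"
    and C: "\<forall>F. finite F \<longrightarrow> F \<subseteq> pos_evens \<longrightarrow> (\<Sum>p\<in>F. (c p)\<^sup>2) \<le> C"
    and N: "1 \<le> N" and \<sigma>: "\<sigma> \<in> spin_configs N"
  shows exp_majorant_measurable: "(\<lambda>\<omega>. exp_majorant c (\<lambda>is. g is \<omega>) N \<sigma> t) \<in> borel_measurable M"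
    and exp_majorant_moment:
      "(\<integral>\<^sup>+\<omega>. exp_majorant c (\<lambda>is. g is \<omega>) N \<sigma> t \<partial>M) \<le> ennreal (exp (t\<^sup>2 * real N * C / 2))"
    and exp_hamiltonian_le_majorant:
      "AE \<omega> in M. ennreal (exp (t * hamiltonian c (\<lambda>is. g is \<omega>) N \<sigma>)) \<le> exp_majorant c (\<lambda>is. g is \<omega>) N \<sigma> t"
proof -
  define S where "S n \<omega> = (\<Sum>p<n. level c (\<lambda>is. g is \<omega>) N \<sigma> p)" for n \<omega>
  define F where "F n = {..<n} \<inter> pos_evens" for n
  define J where "J n = (\<Union>p\<in>F n. multi_indices N p)" for n
  have F: "finite (F n)" "F n \<subseteq> pos_evens" for n
    by (auto simp: F_def)
  have J: "finite (J n)" "J n \<subseteq> all_multi_indices" for n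
    unfolding J_def
    by (intro finite_UN_I F finite_multi_indices, intro UN_least multi_indices_subset_all subsetD[OF F(2)])
  \<comment> \<open>The index sets are disjoint because the length of a list determines
    \<open>p\<close>.\<close>
  have sum_J: "(\<Sum>is\<in>J n. f is) = (\<Sum>p\<in>F n. \<Sum>is\<in>multi_indices N p. f is)" for f :: "nat list \<Rightarrow> real" and n
    unfolding J_def
    by (rule sum.UNION_disjoint) (use F finite_multi_indices in \<open>auto simp: multi_indices_def\<close>)
  have S_eq: "t * S n \<omega> = (\<Sum>is\<in>J n. t * coupling c N \<sigma> is * g is \<omega>)" for n \<omega>
    unfolding S_def sum_J
    by (simp add: level_def sum.inter_restrict[symmetric] F_def sum_distrib_left mult.assoc)
  have meas [measurable]: "(\<lambda>\<omega>. ennreal (exp (t * S n \<omega>))) \<in> borel_measurable M" for n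
  proof -
    have [measurable]: "\<And>is. is \<in> J n \<Longrightarrow> g is \<in> borel_measurable M"
      using iid_std_normal_measurable[OF g] J by blast
    show ?thesis
      unfolding S_eq by simp
  qed
  have moment: "(\<integral>\<^sup>+\<omega>. ennreal (exp (t * S n \<omega>)) \<partial>M) \<le> ennreal (exp (t\<^sup>2 * real N * C / 2))" for n
  proof -
    have "(\<Sum>is\<in>J n. (t * coupling c N \<sigma> is)\<^sup>2) = t\<^sup>2 * real N * (\<Sum>p\<in>F n. (c p)\<^sup>2)"
      unfolding sum_J
      by (simp add: power_mult_distrib sum_distrib_left[symmetric] sum_coupling_sq[OF N \<sigma>] mult.assoc)
    also have "\<dots> \<le> t\<^sup>2 * real N * C"
      by (intro mult_left_mono C[rule_format] F) auto
    finally show ?thesis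
      unfolding S_eq nn_integral_exp_linear_std_normal[OF g J] by (intro ennreal_leI) simp
  qed
  define Y where "Y \<omega> = liminf (\<lambda>n. ennreal (exp (t * S n \<omega>)))" for \<omega>
  have Y: "exp_majorant c (\<lambda>is. g is \<omega>) N \<sigma> t = Y \<omega>" for \<omega>
    by (simp only: Y_def S_def exp_majorant_def)
  show "(\<lambda>\<omega>. exp_majorant c (\<lambda>is. g is \<omega>) N \<sigma> t) \<in> borel_measurable M"
    unfolding Y Y_def by measurable
  show "(\<integral>\<^sup>+\<omega>. exp_majorant c (\<lambda>is. g is \<omega>) N \<sigma> t \<partial>M) \<le> ennreal (exp (t\<^sup>2 * real N * C / 2))"
  proof -
    have "(\<integral>\<^sup>+\<omega>. Y \<omega> \<partial>M) \<le> liminf (\<lambda>n. \<integral>\<^sup>+\<omega>. ennreal (exp (t * S n \<omega>)) \<partial>M)"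
      unfolding Y_def by (rule nn_integral_liminf) (rule meas)
    also have "\<dots> \<le> liminf (\<lambda>n. ennreal (exp (t\<^sup>2 * real N * C / 2)))"
      by (intro Liminf_mono always_eventually allI moment)
    also have "\<dots> = ennreal (exp (t\<^sup>2 * real N * C / 2))"
      by (rule Liminf_const) simp
    finally show ?thesis
      unfolding Y .
  qed
  show "AE \<omega> in M. ennreal (exp (t * hamiltonian c (\<lambda>is. g is \<omega>) N \<sigma>)) \<le> exp_majorant c (\<lambda>is. g is \<omega>) N \<sigma> t"
    unfolding Y
    using AE_summable_level[OF g c N \<sigma>]
  proof eventually_elim
    fix \<omega>
    assume abs: "summable (\<lambda>p. \<bar>level c (\<lambda>is. g is \<omega>) N \<sigma> p\<bar>)"
    then have sums: "level c (\<lambda>is. g is \<omega>) N \<sigma> sums (\<Sum>p. level c (\<lambda>is. g is \<omega>) N \<sigma> p)"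
      by (simp add: summable_sums summable_rabs_cancel)
    \<comment> \<open>Absolute convergence identifies the unordered sum with the series.\<close>
    have "hamiltonian c (\<lambda>is. g is \<omega>) N \<sigma> = (\<Sum>p. level c (\<lambda>is. g is \<omega>) N \<sigma> p)"
      unfolding hamiltonian_eq_infsum_level
      by (rule infsumI, rule norm_summable_imp_has_sum) (use abs sums in simp_all)
    with sums have "(\<lambda>n. S n \<omega>) \<longlonglongrightarrow> hamiltonian c (\<lambda>is. g is \<omega>) N \<sigma>"
      by (simp add: S_def sums_def)
    then have "(\<lambda>n. ennreal (exp (t * S n \<omega>))) \<longlonglongrightarrow> ennreal (exp (t * hamiltonian c (\<lambda>is. g is \<omega>) N \<sigma>))"
      by (intro tendsto_ennrealI tendsto_intros)
    then show "ennreal (exp (t * hamiltonian c (\<lambda>is. g is \<omega>) N \<sigma>)) \<le> Y \<omega>"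
      unfolding Y_def by (rule eq_refl[OF lim_imp_Liminf[OF trivial_limit_sequentially, symmetric]])
  qed
qed

text \<open>Fatou's lemma replaces the Borel--Cantelli argument.\<close>

lemma (in prob_space) limit_le_exp_rate:
  fixes X :: "nat \<Rightarrow> 'a \<Rightarrow> real"
  assumes Y: "\<And>N. 1 \<le> N \<Longrightarrow> Y N \<in> borel_measurable M"
    and moment: "\<And>N. 1 \<le> N \<Longrightarrow> (\<integral>\<^sup>+\<omega>. Y N \<omega> \<partial>M) \<le> ennreal (exp (real N * a))"
    and XY: "\<And>N. 1 \<le> N \<Longrightarrow> AE \<omega> in M. ennreal (exp (real N * X N \<omega>)) \<le> Y N \<omega>"
    and lim: "AE \<omega> in M. (\<lambda>N. X N \<omega>) \<longlonglongrightarrow> l"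
  shows "l \<le> a"
proof (rule ccontr)
  assume "\<not> l \<le> a"
  then have "a < l" by simp
  \<comment> \<open>Normalised to have expectation at most 1. The shift by one keeps the index in
    the range where the hypotheses hold.\<close>
  define Z where "Z n \<omega> = ennreal (exp (- (real (Suc n) * a))) * Y (Suc n) \<omega>" for n \<omega>
  have [measurable]: "Y (Suc n) \<in> borel_measurable M" for n
    by (rule Y) simp
  have [measurable]: "Z n \<in> borel_measurable M" for n
    unfolding Z_def[abs_def] by measurable
  have Z_moment: "(\<integral>\<^sup>+\<omega>. Z n \<omega> \<partial>M) \<le> 1" for n
  proof -
    have "(\<integral>\<^sup>+\<omega>. Z n \<omega> \<partial>M) = ennreal (exp (- (real (Suc n) * a))) * (\<integral>\<^sup>+\<omega>. Y (Suc n) \<omega> \<partial>M)"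
      unfolding Z_def by (rule nn_integral_cmult) simp
    also have "\<dots> \<le> ennreal (exp (- (real (Suc n) * a))) * ennreal (exp (real (Suc n) * a))"
      by (intro mult_left_mono moment) auto
    also have "\<dots> = 1"
      by (simp add: ennreal_mult[symmetric] exp_minus)
    finally show ?thesis .
  qed
  have "AE \<omega> in M. \<forall>n. ennreal (exp (real (Suc n) * X (Suc n) \<omega>)) \<le> Y (Suc n) \<omega>"
    unfolding AE_all_countable by (intro allI XY) simp
  with lim have "AE \<omega> in M. liminf (\<lambda>n. Z n \<omega>) = \<infinity>"
  proof eventually_elim
    fix \<omega>
    assume conv: "(\<lambda>N. X N \<omega>) \<longlonglongrightarrow> l"
      and le: "\<forall>n. ennreal (exp (real (Suc n) * X (Suc n) \<omega>)) \<le> Y (Suc n) \<omega>"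
    have "(\<lambda>n. X (Suc n) \<omega> - a) \<longlonglongrightarrow> l - a"
      using LIMSEQ_Suc[OF conv] by (intro tendsto_intros)
    moreover have "filterlim (\<lambda>n. real (Suc n)) at_top sequentially"
      by (rule filterlim_compose[OF filterlim_real_sequentially filterlim_Suc])
    ultimately have "filterlim (\<lambda>n. (X (Suc n) \<omega> - a) * real (Suc n)) at_top sequentially"
      using \<open>a < l\<close> by (intro filterlim_tendsto_pos_mult_at_top) auto
    then have "filterlim (\<lambda>n. exp ((X (Suc n) \<omega> - a) * real (Suc n))) at_top sequentially"
      by (rule filterlim_compose[OF exp_at_top])
    then have "(\<lambda>n. ennreal (exp ((X (Suc n) \<omega> - a) * real (Suc n)))) \<longlonglongrightarrow> \<infinity>"
      by (simp add: ennreal_tendsto_top_eq_at_top)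
    then have "liminf (\<lambda>n. ennreal (exp ((X (Suc n) \<omega> - a) * real (Suc n)))) = \<infinity>"
      by (intro lim_imp_Liminf) simp
    moreover have "ennreal (exp ((X (Suc n) \<omega> - a) * real (Suc n))) \<le> Z n \<omega>" for n
    proof -
      have "(X (Suc n) \<omega> - a) * real (Suc n) = - (real (Suc n) * a) + real (Suc n) * X (Suc n) \<omega>"
        by (simp add: algebra_simps)
      then have "ennreal (exp ((X (Suc n) \<omega> - a) * real (Suc n)))
          = ennreal (exp (- (real (Suc n) * a))) * ennreal (exp (real (Suc n) * X (Suc n) \<omega>))"
        by (simp only: exp_add ennreal_mult[symmetric] exp_ge_zero)
      then show ?thesis
        unfolding Z_def using le by (auto intro: mult_left_mono)
    qed
    then have "liminf (\<lambda>n. ennreal (exp ((X (Suc n) \<omega> - a) * real (Suc n)))) \<le> liminf (\<lambda>n. Z n \<omega>)"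
      by (intro Liminf_mono always_eventually) auto
    ultimately show "liminf (\<lambda>n. Z n \<omega>) = \<infinity>"
      by (simp add: top_unique)
  qed
  \<comment> \<open>If \<open>a < l\<close>, the lower limit of \<open>Z\<close> is almost surely
    infinite, whereas Fatou's lemma bounds its expectation by 1.\<close>
  then have "(\<integral>\<^sup>+\<omega>. \<infinity> \<partial>M) = (\<integral>\<^sup>+\<omega>. liminf (\<lambda>n. Z n \<omega>) \<partial>M)"
    by (intro nn_integral_cong_AE) (simp add: eq_commute)
  also have "(\<integral>\<^sup>+\<omega>. liminf (\<lambda>n. Z n \<omega>) \<partial>M) \<le> liminf (\<lambda>n. \<integral>\<^sup>+\<omega>. Z n \<omega> \<partial>M)"
    by (rule nn_integral_liminf) simp
  also have "liminf (\<lambda>n. \<integral>\<^sup>+\<omega>. Z n \<omega> \<partial>M) \<le> liminf (\<lambda>n. 1)"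
    by (intro Liminf_mono always_eventually allI Z_moment)
  finally show False
    by (simp add: emeasure_space_1 Liminf_const top_unique)
qed

section \<open>The limiting ground state energy\<close>

lemma field_hamiltonian_le_max_energy:
  "\<sigma> \<in> spin_configs N \<Longrightarrow> field_hamiltonian c x h N \<sigma> / real N \<le> max_energy c x h N"
  unfolding max_energy_def by (intro Max_ge finite_imageI finite_spin_configs imageI)

lemma max_energy_attained:
  obtains \<sigma> where "\<sigma> \<in> spin_configs N" "max_energy c x h N = field_hamiltonian c x h N \<sigma> / real N"
proof -
  have "max_energy c x h N \<in> (\<lambda>\<sigma>. field_hamiltonian c x h N \<sigma> / real N) ` spin_configs N"
    unfolding max_energy_def by (intro Max_in finite_imageI finite_spin_configs) (simp add: spin_configs_nonempty)
  then show ?thesis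
    using that by blast
qed

text \<open>For a fixed configuration the energy is affine in the field. The maximiser at the
  intermediate field is a competitor at both endpoints.\<close>

lemma convex_on_max_energy: "convex_on UNIV (\<lambda>h. max_energy c x h N)"
proof (rule convex_onI)
  fix t a b :: real
  assume t: "0 < t" "t < 1"
  define h where "h = (1 - t) *\<^sub>R a + t *\<^sub>R b"
  obtain \<sigma> where \<sigma>: "\<sigma> \<in> spin_configs N" "max_energy c x h N = field_hamiltonian c x h N \<sigma> / real N"
    by (rule max_energy_attained)
  have "field_hamiltonian c x h N \<sigma>
      = (1 - t) * field_hamiltonian c x a N \<sigma> + t * field_hamiltonian c x b N \<sigma>"
    by (simp add: field_hamiltonian_def h_def algebra_simps)
  then have "max_energy c x h N
      = (1 - t) * (field_hamiltonian c x a N \<sigma> / real N) + t * (field_hamiltonian c x b N \<sigma> / real N)"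
    by (simp add: \<sigma>(2) add_divide_distrib)
  also have "\<dots> \<le> (1 - t) * max_energy c x a N + t * max_energy c x b N"
    using t by (intro add_mono mult_left_mono field_hamiltonian_le_max_energy \<sigma>(1)) auto
  finally show "max_energy c x ((1 - t) *\<^sub>R a + t *\<^sub>R b) N
      \<le> (1 - t) * max_energy c x a N + t * max_energy c x b N"
    by (simp add: h_def)
qed simp

text \<open>The sum factorises over sites: a spin 1 contributes 1 and a spin -1 contributes
  \<open>exp (- 2 * b)\<close>.\<close>

lemma sum_exp_spin_configs:
  "(\<Sum>\<sigma>\<in>spin_configs N. exp (b * ((\<Sum>i=1..N. \<sigma> i) - real N))) = (1 + exp (- 2 * b)) ^ N"
proof -
  have "(\<Sum>\<sigma>\<in>spin_configs N. exp (b * ((\<Sum>i=1..N. \<sigma> i) - real N)))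
      = (\<Sum>\<sigma>\<in>spin_configs N. \<Prod>i\<in>{1..N}. exp (b * (\<sigma> i - 1)))"
    by (simp add: exp_sum[symmetric] sum_distrib_left[symmetric] sum_subtractf)
  also have "\<dots> = (\<Prod>i\<in>{1..N}. \<Sum>s\<in>{-1, 1}. exp (b * (s - 1)))"
    unfolding spin_configs_def by (rule prod_sum_PiE[symmetric]) auto
  also have "\<dots> = (1 + exp (- 2 * b)) ^ N"
    by (simp add: algebra_simps)
  finally show ?thesis .
qed

section \<open>Bounds and convexity of the limiting energy\<close>

context prob_space
begin

lemma max_energy_limit_ge:
  assumes g: "iid_std_normal M all_multi_indices g"
    and c: "summable (\<lambda>p. if p \<in> pos_evens then \<bar>c p\<bar> else 0)"
    and C: "\<forall>F. finite F \<longrightarrow> F \<subseteq> pos_evens \<longrightarrow> (\<Sum>p\<in>F. (c p)\<^sup>2) \<le> C"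
    and lim: "AE \<omega> in M. (\<lambda>N. max_energy c (\<lambda>is. g is \<omega>) h N) \<longlonglongrightarrow> m"
    and "0 < b"
  shows "- (b * C / 2) \<le> m - h"
proof -
  define \<sigma> :: "nat \<Rightarrow> nat \<Rightarrow> real" where "\<sigma> N = restrict (\<lambda>_. 1) {1..N}" for N
  have \<sigma>: "\<sigma> N \<in> spin_configs N" for N
    unfolding \<sigma>_def spin_configs_def by simp
  define Y where "Y N \<omega> = exp_majorant c (\<lambda>is. g is \<omega>) N (\<sigma> N) (- b)" for N \<omega>
  note Y = exp_majorant[OF g c C _ \<sigma>, of _ "- b", folded Y_def]
  have "- b * (m - h) \<le> b\<^sup>2 * C / 2"
  \<comment> \<open>The exponential rate only gives upper bounds, so it is applied to the negated
    energy; this is why the majorant is taken at \<open>- b\<close>.\<close>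
  proof (rule limit_le_exp_rate[of Y])
    show "AE \<omega> in M. (\<lambda>N. - b * (max_energy c (\<lambda>is. g is \<omega>) h N - h)) \<longlonglongrightarrow> - b * (m - h)"
      using lim by eventually_elim (intro tendsto_intros)
    fix N :: nat
    assume N: "1 \<le> N"
    show "Y N \<in> borel_measurable M"
      by (rule Y(1)[OF N])
    show "(\<integral>\<^sup>+\<omega>. Y N \<omega> \<partial>M) \<le> ennreal (exp (real N * (b\<^sup>2 * C / 2)))"
      using Y(2)[OF N] by (simp add: mult_ac)
    show "AE \<omega> in M. ennreal (exp (real N * (- b * (max_energy c (\<lambda>is. g is \<omega>) h N - h)))) \<le> Y N \<omega>"
      using Y(3)[OF N]
    proof eventually_elim
      fix \<omega>
      assume le: "ennreal (exp (- b * hamiltonian c (\<lambda>is. g is \<omega>) N (\<sigma> N))) \<le> Y N \<omega>"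
      have "hamiltonian c (\<lambda>is. g is \<omega>) N (\<sigma> N) + h * real N \<le> real N * max_energy c (\<lambda>is. g is \<omega>) h N"
        using field_hamiltonian_le_max_energy[OF \<sigma>, where c = c and x = "\<lambda>is. g is \<omega>" and h = h and N = N] N
        by (simp add: field_hamiltonian_def \<sigma>_def divide_simps mult_ac)
      then have "b * hamiltonian c (\<lambda>is. g is \<omega>) N (\<sigma> N)
          \<le> b * (real N * (max_energy c (\<lambda>is. g is \<omega>) h N - h))"
        using \<open>0 < b\<close> by (intro mult_left_mono) (auto simp: algebra_simps)
      then have "ennreal (exp (real N * (- b * (max_energy c (\<lambda>is. g is \<omega>) h N - h))))
          \<le> ennreal (exp (- b * hamiltonian c (\<lambda>is. g is \<omega>) N (\<sigma> N)))"
        by (intro ennreal_leI) (simp add: mult_ac)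
      with le show "ennreal (exp (real N * (- b * (max_energy c (\<lambda>is. g is \<omega>) h N - h)))) \<le> Y N \<omega>"
        by (rule order_trans[rotated])
    qed
  qed
  then have "b * (- (b * C / 2)) \<le> b * (m - h)"
    by (simp add: power2_eq_square)
  then show ?thesis
    using \<open>0 < b\<close> by (simp only: mult_le_cancel_left_pos)
qed

text \<open>The exponential of a maximum is at most the sum of the exponentials over the cube.
  Splitting off the deterministic field factor leaves the same Gaussian bound for every
  configuration.\<close>

lemma max_energy_limit_le:
  assumes g: "iid_std_normal M all_multi_indices g"
    and c: "summable (\<lambda>p. if p \<in> pos_evens then \<bar>c p\<bar> else 0)"
    and C: "\<forall>F. finite F \<longrightarrow> F \<subseteq> pos_evens \<longrightarrow> (\<Sum>p\<in>F. (c p)\<^sup>2) \<le> C"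
    and lim: "AE \<omega> in M. (\<lambda>N. max_energy c (\<lambda>is. g is \<omega>) h N) \<longlonglongrightarrow> m"
    and "0 < b"
  shows "m - h \<le> b * C / 2 + ln (1 + exp (- 2 * (b * h))) / b"
proof -
  define Y where "Y N \<sigma> \<omega> = exp_majorant c (\<lambda>is. g is \<omega>) N \<sigma> b" for N \<sigma> \<omega>
  note Y = exp_majorant[OF g c C, of _ _ b, folded Y_def]
  \<comment> \<open>Subtracting \<open>h\<close> from the energy per site puts
    \<open>- real N\<close> into the exponent; the weights then sum to \<open>q ^ N\<close>.\<close>
  define w where "w N \<sigma> = exp (b * h * ((\<Sum>i=1..N. \<sigma> i) - real N))" for N and \<sigma> :: "nat \<Rightarrow> real"
  define q where "q = 1 + exp (- 2 * (b * h))"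
  have "0 < q"
    by (simp add: q_def add_pos_pos)
  define Z where "Z N \<omega> = (\<Sum>\<sigma>\<in>spin_configs N. ennreal (w N \<sigma>) * Y N \<sigma> \<omega>)" for N \<omega>
  have "b * (m - h) \<le> b\<^sup>2 * C / 2 + ln q"
  proof (rule limit_le_exp_rate[of Z])
    show "AE \<omega> in M. (\<lambda>N. b * (max_energy c (\<lambda>is. g is \<omega>) h N - h)) \<longlonglongrightarrow> b * (m - h)"
      using lim by eventually_elim (intro tendsto_intros)
    fix N :: nat
    assume N: "1 \<le> N"
    note [measurable] = Y(1)[OF N]
    show "Z N \<in> borel_measurable M"
      unfolding Z_def[abs_def] by measurable
    have "(\<integral>\<^sup>+\<omega>. Z N \<omega> \<partial>M) = (\<Sum>\<sigma>\<in>spin_configs N. ennreal (w N \<sigma>) * (\<integral>\<^sup>+\<omega>. Y N \<sigma> \<omega> \<partial>M))"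
      unfolding Z_def by (subst nn_integral_sum) (auto intro!: sum.cong nn_integral_cmult)
    also have "\<dots> \<le> (\<Sum>\<sigma>\<in>spin_configs N. ennreal (w N \<sigma>) * ennreal (exp (b\<^sup>2 * real N * C / 2)))"
      by (intro sum_mono mult_left_mono Y(2) N) auto
    also have "\<dots> = ennreal ((\<Sum>\<sigma>\<in>spin_configs N. w N \<sigma>) * exp (b\<^sup>2 * real N * C / 2))"
      by (simp add: w_def sum_distrib_right ennreal_mult[symmetric])
    also have "(\<Sum>\<sigma>\<in>spin_configs N. w N \<sigma>) = q ^ N"
      unfolding w_def sum_exp_spin_configs q_def ..
    also have "q ^ N = exp (real N * ln q)"
      using \<open>0 < q\<close> by (simp add: exp_of_nat_mult)
    finally show "(\<integral>\<^sup>+\<omega>. Z N \<omega> \<partial>M) \<le> ennreal (exp (real N * (b\<^sup>2 * C / 2 + ln q)))"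
      by (simp add: exp_add[symmetric] algebra_simps)
    have "AE \<omega> in M. \<forall>\<sigma>\<in>spin_configs N. ennreal (exp (b * hamiltonian c (\<lambda>is. g is \<omega>) N \<sigma>)) \<le> Y N \<sigma> \<omega>"
      by (intro AE_finite_allI finite_spin_configs Y(3) N)
    then show "AE \<omega> in M. ennreal (exp (real N * (b * (max_energy c (\<lambda>is. g is \<omega>) h N - h)))) \<le> Z N \<omega>"
    proof eventually_elim
      fix \<omega>
      assume le: "\<forall>\<sigma>\<in>spin_configs N. ennreal (exp (b * hamiltonian c (\<lambda>is. g is \<omega>) N \<sigma>)) \<le> Y N \<sigma> \<omega>"
      obtain \<sigma> where \<sigma>: "\<sigma> \<in> spin_configs N"
        "max_energy c (\<lambda>is. g is \<omega>) h N = field_hamiltonian c (\<lambda>is. g is \<omega>) h N \<sigma> / real N"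
        by (rule max_energy_attained)
      have "real N * (b * (max_energy c (\<lambda>is. g is \<omega>) h N - h))
          = b * h * ((\<Sum>i=1..N. \<sigma> i) - real N) + b * hamiltonian c (\<lambda>is. g is \<omega>) N \<sigma>"
        using N by (simp add: \<sigma>(2) field_hamiltonian_def field_simps)
      then have "ennreal (exp (real N * (b * (max_energy c (\<lambda>is. g is \<omega>) h N - h))))
          = ennreal (w N \<sigma>) * ennreal (exp (b * hamiltonian c (\<lambda>is. g is \<omega>) N \<sigma>))"
        by (simp only: exp_add ennreal_mult w_def exp_ge_zero)
      also have "\<dots> \<le> ennreal (w N \<sigma>) * Y N \<sigma> \<omega>"
        using le \<sigma>(1) by (intro mult_left_mono) auto
      also have "\<dots> \<le> Z N \<omega>"
        unfolding Z_def by (intro member_le_sum \<sigma>(1) finite_spin_configs) auto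
      finally show "ennreal (exp (real N * (b * (max_energy c (\<lambda>is. g is \<omega>) h N - h)))) \<le> Z N \<omega>" .
    qed
  qed
  then have "b * (m - h) \<le> b * (b * C / 2 + ln q / b)"
    using \<open>0 < b\<close> by (simp add: power2_eq_square distrib_left)
  then show ?thesis
    using \<open>0 < b\<close> by (simp add: q_def)
qed

text \<open>Each convexity inequality involves only three fields, so it is enough to intersect three
  almost sure events. The resulting inequality between constants then holds outright on a
  probability space.\<close>

lemma convex_on_max_energy_limit:
  assumes lim: "\<And>h. AE \<omega> in M. (\<lambda>N. max_energy c (\<lambda>is. g is \<omega>) h N) \<longlonglongrightarrow> m h"
  shows "convex_on UNIV m"
proof (rule convex_onI)
  fix t a b :: real
  assume t: "0 < t" "t < 1"
  define h where "h = (1 - t) *\<^sub>R a + t *\<^sub>R b"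
  have "AE \<omega> in M. m h \<le> (1 - t) * m a + t * m b"
    using lim[of a] lim[of b] lim[of h]
  proof eventually_elim
    fix \<omega>
    assume conv: "(\<lambda>N. max_energy c (\<lambda>is. g is \<omega>) a N) \<longlonglongrightarrow> m a"
      "(\<lambda>N. max_energy c (\<lambda>is. g is \<omega>) b N) \<longlonglongrightarrow> m b"
      "(\<lambda>N. max_energy c (\<lambda>is. g is \<omega>) h N) \<longlonglongrightarrow> m h"
    have "max_energy c (\<lambda>is. g is \<omega>) h N
        \<le> (1 - t) * max_energy c (\<lambda>is. g is \<omega>) a N + t * max_energy c (\<lambda>is. g is \<omega>) b N" for N
      using convex_onD[OF convex_on_max_energy, of t] t by (simp add: h_def)
    then have "\<forall>\<^sub>F N in sequentially. max_energy c (\<lambda>is. g is \<omega>) h N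
        \<le> (1 - t) * max_energy c (\<lambda>is. g is \<omega>) a N + t * max_energy c (\<lambda>is. g is \<omega>) b N"
      by simp
    moreover have "(\<lambda>N. (1 - t) * max_energy c (\<lambda>is. g is \<omega>) a N + t * max_energy c (\<lambda>is. g is \<omega>) b N)
        \<longlonglongrightarrow> (1 - t) * m a + t * m b"
      by (rule tendsto_add[OF tendsto_mult_left[OF conv(1)] tendsto_mult_left[OF conv(2)]])
    ultimately show "m h \<le> (1 - t) * m a + t * m b"
      using tendsto_le[OF trivial_limit_sequentially _ conv(3)] by blast
  qed
  then show "m ((1 - t) *\<^sub>R a + t *\<^sub>R b) \<le> (1 - t) * m a + t * m b"
    by (simp add: h_def)
qed simp

end

section \<open>Differentiable convex functions on the line\<close>

context
  fixes f :: "real \<Rightarrow> real"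
  assumes convex: "convex_on UNIV f"
    and differentiable: "\<And>x. f differentiable (at x)"
begin

lemma convex_has_deriv: "(f has_real_derivative deriv f x) (at x)"
  using differentiable[of x] by (simp add: DERIV_deriv_iff_real_differentiable)

lemma convex_above_deriv_tangent: "deriv f x * (y - x) \<le> f y - f x"
  using convex_on_imp_above_tangent[OF convex, of x y "deriv f x"] convex_has_deriv by simp

text \<open>Add the tangent inequalities at \<open>x\<close> and at \<open>y\<close>.\<close>

lemma convex_deriv_mono:
  assumes "x \<le> y"
  shows "deriv f x \<le> deriv f y"
proof (cases "x = y")
  case False
  have "deriv f x * (y - x) \<le> deriv f y * (y - x)"
    using convex_above_deriv_tangent[of x y] convex_above_deriv_tangent[of y x] by (simp add: algebra_simps)
  then show ?thesis
    using False assms by simp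
qed simp

lemma convex_deriv_isCont: "isCont (deriv f) x"
proof -
  define q where "q u = (f (x + 2 * u) - f (x + u)) / u" for u
  \<comment> \<open>The chain rule gives twice the derivative minus the derivative, so
    differentiability at \<open>x\<close> alone determines the limit of \<open>q\<close>.\<close>
  have "((\<lambda>u. f (x + 2 * u) - f (x + u)) has_real_derivative deriv f x) (at 0)"
    using convex_has_deriv[of x] by (auto intro!: derivative_eq_intros DERIV_chain2[where f = f])
  then have q: "q \<midarrow>0\<rightarrow> deriv f x"
    by (simp add: DERIV_def q_def[abs_def])
  \<comment> \<open>The tangent at \<open>x + u\<close>, evaluated at \<open>x + 2 * u\<close>, traps the derivative at \<open>x + u\<close>
      between its value at \<open>x\<close> and \<open>q u\<close>.\<close>
  have "\<bar>deriv f (x + u) - deriv f x\<bar> \<le> \<bar>q u - deriv f x\<bar>" if "u \<noteq> 0" for u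
  proof -
    have tangent: "deriv f (x + u) * u \<le> f (x + 2 * u) - f (x + u)"
      using convex_above_deriv_tangent[of "x + u" "x + 2 * u"] by simp
    show ?thesis
    proof (cases "0 < u")
      case True
      then have "deriv f (x + u) \<le> q u"
        using tangent by (simp add: q_def pos_le_divide_eq)
      then show ?thesis
        using True convex_deriv_mono[of x "x + u"] by simp
    next
      case False
      then have "u < 0" using that by simp
      then have "q u \<le> deriv f (x + u)"
        using tangent by (simp add: q_def neg_divide_le_eq)
      then show ?thesis
        using \<open>u < 0\<close> convex_deriv_mono[of "x + u" x] by simp
    qed
  qed
  then have "((\<lambda>u. deriv f (x + u)) \<longlongrightarrow> deriv f x) (at 0)"
    using q by (intro metric_tendsto_imp_tendsto[OF q]) (auto simp: eventually_at_filter dist_real_def)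
  then show ?thesis
    by (simp add: isCont_iff)
qed

text \<open>The tangent at \<open>y\<close>, evaluated at \<open>x\<close>, gives
  \<open>f y - y * deriv f y \<le> f x - x * deriv f y\<close>. Since \<open>x\<close> is
  nonnegative and the derivative increases, the right side is at most the intercept at
  \<open>x\<close>.\<close>

lemma convex_tangent_intercept_antimono: "antimono_on {0..} (\<lambda>x. f x - x * deriv f x)"
proof (rule monotone_onI)
  fix x y :: real
  assume "x \<in> {0..}" "x \<le> y"
  then have "x * deriv f x \<le> x * deriv f y"
    by (intro mult_left_mono convex_deriv_mono) auto
  then show "f y - y * deriv f y \<le> f x - x * deriv f x"
    using convex_above_deriv_tangent[of y x] by (simp add: algebra_simps)
qed

text \<open>Convergence of \<open>f x - x\<close> does not by itself control
  \<open>x * (deriv f x - 1)\<close>. Evaluating the tangent at \<open>x\<close> at the points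
  \<open>2 * x\<close> and \<open>x / 2\<close>, whose distances from \<open>x\<close> are
  proportional to \<open>x\<close>, squeezes this product to 0.\<close>

lemma convex_tangent_intercept_tendsto_0:
  assumes asymptote: "((\<lambda>x. f x - x) \<longlongrightarrow> 0) at_top"
  shows "((\<lambda>x. f x - x * deriv f x) \<longlongrightarrow> 0) at_top"
proof -
  define d where "d x = f x - x" for x
  have d: "(d \<longlongrightarrow> 0) at_top"
    using asymptote by (simp add: d_def[abs_def])
  have d2: "((\<lambda>x. d (2 * x)) \<longlongrightarrow> 0) at_top" "((\<lambda>x. d (x / 2)) \<longlongrightarrow> 0) at_top"
    by (rule filterlim_compose[OF d], real_asymp)+
  have upper: "x * (deriv f x - 1) \<le> d (2 * x) - d x" for x
    using convex_above_deriv_tangent[of x "2 * x"] by (simp add: d_def algebra_simps)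
  have lower: "2 * (d x - d (x / 2)) \<le> x * (deriv f x - 1)" for x
    using convex_above_deriv_tangent[of x "x / 2"] by (simp add: d_def algebra_simps)
  have "((\<lambda>x. d (2 * x) - d x) \<longlongrightarrow> 0) at_top"
    using tendsto_diff[OF d2(1) d] by simp
  moreover have "((\<lambda>x. 2 * (d x - d (x / 2))) \<longlongrightarrow> 0) at_top"
    using tendsto_mult[OF tendsto_const tendsto_diff[OF d d2(2)], of 2] by simp
  ultimately have "((\<lambda>x. x * (deriv f x - 1)) \<longlongrightarrow> 0) at_top"
    by (rule tendsto_sandwich[OF always_eventually[OF allI[OF lower]] always_eventually[OF allI[OF upper]], rotated])
  \<comment> \<open>The intercept equals \<open>d x - x * (deriv f x - 1)\<close>.\<close>
  from tendsto_diff[OF d this] show ?thesis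
    by (simp add: d_def algebra_simps)
qed

end

section \<open>The tangent intercept of the limiting energy\<close>

theorem proposition1:
  fixes P :: "'a measure"
    and g :: "nat list \<Rightarrow> 'a \<Rightarrow> real"
    and c :: "nat \<Rightarrow> real"
    and M :: "real \<Rightarrow> real"
  assumes "prob_space P"
    and "iid_std_normal P all_multi_indices g"
    and "\<exists>p\<in>pos_evens. c p \<noteq> 0"
    and "(\<lambda>p. 2 ^ p * (c p)\<^sup>2) summable_on pos_evens"
    and "\<And>h. AE \<omega> in P. (\<lambda>N. max_energy c (\<lambda>is. g is \<omega>) h N) \<longlonglongrightarrow> M h"
    and "\<And>h. M differentiable (at h)"
  shows "antimono_on {0..} (E_of M) \<and>
         continuous_on {0..} (E_of M) \<and>
         E_of M 0 = M 0 \<and>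
         (E_of M \<longlongrightarrow> 0) at_top"
proof -
  interpret prob_space P by fact
  define C where "C = (\<Sum>\<^sub>\<infinity>p\<in>pos_evens. (c p)\<^sup>2)"
  have sq: "(\<lambda>p. (c p)\<^sup>2) summable_on pos_evens"
    using assms(4) by (rule summable_on_comparison_test) (auto simp: mult_le_cancel_right1)
  have C: "\<forall>F. finite F \<longrightarrow> F \<subseteq> pos_evens \<longrightarrow> (\<Sum>p\<in>F. (c p)\<^sup>2) \<le> C"
    unfolding C_def by (intro allI impI finite_sum_le_infsum[OF sq]) auto
  have "0 \<le> C"
    using C[rule_format, of "{}"] by simp
  have weighted: "summable (\<lambda>p. if p \<in> pos_evens then 2 ^ p * (c p)\<^sup>2 else 0)"
  proof (rule summable_on_imp_summable)
    show "(\<lambda>p. if p \<in> pos_evens then 2 ^ p * (c p)\<^sup>2 else 0) summable_on UNIV"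
      using assms(4) by (rule summable_on_cong_neutral[THEN iffD1, rotated -1]) auto
  qed
  \<comment> \<open>By AM-GM, \<open>\<bar>c p\<bar> \<le> 2 ^ p * (c p)\<^sup>2 + (1 / 2) ^ p\<close>.\<close>
  have summable_c: "summable (\<lambda>p. if p \<in> pos_evens then \<bar>c p\<bar> else 0)"
  proof (rule summable_comparison_test')
    show "summable (\<lambda>p. (if p \<in> pos_evens then 2 ^ p * (c p)\<^sup>2 else 0) + (1 / 2 :: real) ^ p)"
      by (intro summable_add weighted summable_geometric) simp
    fix p :: nat
    assume "0 \<le> p"
    have "0 \<le> 2 ^ p * (\<bar>c p\<bar> - (1 / 2) ^ p)\<^sup>2"
      by simp
    also have "\<dots> = 2 ^ p * (c p)\<^sup>2 - 2 * \<bar>c p\<bar> + (1 / 2) ^ p"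
      by (simp add: power2_diff algebra_simps power2_eq_square power_one_over)
    finally have "\<bar>c p\<bar> \<le> 2 ^ p * (c p)\<^sup>2 + (1 / 2) ^ p"
      by linarith
    then show "norm (if p \<in> pos_evens then \<bar>c p\<bar> else 0)
        \<le> (if p \<in> pos_evens then 2 ^ p * (c p)\<^sup>2 else 0) + (1 / 2) ^ p"
      by simp
  qed
  have lower: "- (b * C / 2) \<le> M h - h"
    and upper: "M h - h \<le> b * C / 2 + ln (1 + exp (- 2 * (b * h))) / b" if "0 < b" for b h
    by (rule max_energy_limit_ge[OF assms(2) summable_c C assms(5) that])
      (rule max_energy_limit_le[OF assms(2) summable_c C assms(5) that])
  have asymptote: "((\<lambda>h. M h - h) \<longlongrightarrow> 0) at_top"
  proof (rule tendstoI)
    fix e :: real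
    assume "0 < e"
    \<comment> \<open>Makes \<open>b * C / 2\<close> smaller than \<open>e / 2\<close>, also when
      \<open>C = 0\<close>. With \<open>b\<close> fixed, a large \<open>h\<close> brings the
      remaining term below \<open>e / 2\<close>.\<close>
    define b where "b = e / (C + 1)"
    have "0 < b"
      using \<open>0 < e\<close> \<open>0 \<le> C\<close> by (simp add: b_def)
    have "b * C < e"
      using \<open>0 < e\<close> \<open>0 \<le> C\<close> by (simp add: b_def divide_simps)
    have "((\<lambda>h. exp (- 2 * (b * h)) / b) \<longlongrightarrow> 0) at_top"
      using \<open>0 < b\<close> by real_asymp
    then have "\<forall>\<^sub>F h in at_top. exp (- 2 * (b * h)) / b < e / 2"
      using \<open>0 < e\<close> by (intro order_tendstoD) auto
    then show "\<forall>\<^sub>F h in at_top. dist (M h - h) 0 < e"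
    proof eventually_elim
      fix h
      assume small: "exp (- 2 * (b * h)) / b < e / 2"
      have "ln (1 + exp (- 2 * (b * h))) / b \<le> exp (- 2 * (b * h)) / b"
        using \<open>0 < b\<close> by (intro divide_right_mono ln_add_one_self_le_self) auto
      with small have "M h - h < e" "- e < M h - h"
        using upper[OF \<open>0 < b\<close>, of h] lower[OF \<open>0 < b\<close>, of h] \<open>b * C < e\<close> \<open>0 < e\<close> by linarith+
      then show "dist (M h - h) 0 < e"
        by (simp add: dist_real_def abs_less_iff)
    qed
  qed
  have convex: "convex_on UNIV M"
    by (rule convex_on_max_energy_limit[OF assms(5)])
  have E: "E_of M = (\<lambda>h. M h - h * deriv M h)"
    by (rule ext) (rule E_of_def)
  \<comment> \<open>The only nontrivial ingredient is continuity of the derivative, which comes from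
    convexity.\<close>
  have "continuous_on {0..} (\<lambda>h. M h - h * deriv M h)"
    by (intro continuous_on_diff continuous_on_mult continuous_on_id continuous_at_imp_continuous_on ballI
        convex_deriv_isCont[OF convex assms(6)] differentiable_imp_continuous_within assms(6))
  then show ?thesis
    unfolding E
    using convex_tangent_intercept_antimono[OF convex assms(6)]
      convex_tangent_intercept_tendsto_0[OF convex assms(6) asymptote]
    by (intro conjI) (assumption | simp)+
qed

end
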